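(* Let $X=[a,b]\subset\mathbb{R}^n$ be a box and let $f:\mathbb{R}^n\to\mathbb{R}$ be a non-convex twice continuously differentiable function. For any $\varepsilon>0$ there exist $t\in\mathbb{N}$ and a subdivision $\mathbf{Y}^t$ of $X$ satisfying $$\max_{k\in M_2(t)}\sum_{i=1}^n\alpha_i^{k}\left(\frac{a_i^{k}-b_i^{k}}{2}\right)^2\le\varepsilon$$ such that $\mathcal{X}_{ap}(t)\subseteq\mathcal{X}_{op}^{\varepsilon}$.
   Context: A box is a set $[a,b]=\prod_{i=1}^n[a_i,b_i]$ with $a_i<b_i$. The approximate solution set is $\mathcal{X}_{op}^{\varepsilon}=\{x\in X: f(x)\le f(y)+\varepsilon\ \forall y\in X\}$. A subdivision $\mathbf{Y}^t=\{Y^1,\dots,Y^{M_t}\}$ of $X$ is a finite family of boxes $Y^{k}=[a^{k},b^{k}]=\prod_{i=1}^n[a_i^k,b_i^k]$ with $X=\bigcup_{k}Y^{k}$ and $Y^{k}\cap Y^{j}$ of Lebesgue measure zero in $\mathbb{R}^n$ for $k\neq j$; the index $t\in\mathbb{N}$ is the number of the division step. $M_t$ also denotes the index set $\{1,\dots,M_t\}$. For a box $Y=[a^Y,b^Y]$ and $d\in\mathbb{R}^n$ with positive entries put $$S(Y,i,d)=\sum_{j\neq i}\max\left\{\left|\min_{x\in Y}\nabla^2 f(x)_{ij}\right|,\left|\max_{x\in Y}\nabla^2 f(x)_{ij}\right|\right\}\frac{d_j}{d_i},$$ and $\tilde\lambda_Y=\min_{i}\left(\min_{x\in Y}\nabla^2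 f(x)_{ii}-S(Y,i,\mathbf{1})\right)$ with $\mathbf{1}=(1,\dots,1)$. Index sets: $M_1(t)=\{k\in M_t:\tilde\lambda_{Y^k}\ge0\}$, $M_2(t)=\{k\in M_t:\tilde\lambda_{Y^k}<0\}$. A maximum over the empty set is $0$. The subdivisions are generated successively: $\mathbf{Y}^0=\{X\}$, and $\mathbf{Y}^{t+1}$ is obtained from $\mathbf{Y}^t$ by keeping each box with index in $M_1(t)$ and replacing each box with index in $M_2(t)$ by the two boxes obtained by halving it at the midpoint of its longest edge (the edge of smallest coordinate index if there are ties). Parameters: for $k\in M_t$, if $\tilde\lambda_{Y^k}\ge 0$ then $\alpha_i^k=0$ for all $i$; otherwise $\alpha_i^k=\max\left\{0,-\tfrac12\left(\min_{x\in Y^k}\nabla^2 f(x)_{ii}-S(Y^k,i,b^k-a^k)\right)\right\}$, $i=1,\dots,n$. Define on $Y^k$ $$F_k^{\alpha^k}(x)=f(x)+\sum_{i=1}^n\alpha_i^k(a_i^k-x_i)(b_i^k-x_i),$$ and $\mathcal{X}_{ap}^{k}=\{x\in Y^k: F_k^{\alpha^k}(x)\le F_k^{\alpha^k}(y)\ \forall y\in Y^k\}$. Put $\mathcal{X}_{ap}^{C\cup NC}(t)=\bigcup_{k\in M_1(t)}\mathcal{X}_{ap}^k\ \cup\ \bigcup_{k\in M_2(t)}\mathcal{X}_{ap}^k$. The solution set of the piecewise convexification problem is $$\mathcal{X}_{ap}(t)=\{x\in\mathcal{X}_{ap}^{C\cup NC}(t): f(x)\le f(y)\ \forall y\in\mathcal{X}_{ap}^{C\cup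 NC}(t)\}.$$ *)

theory Defs
  imports "HOL-Analysis.Analysis"
begin

text \<open>
  The dimension is the cardinality of the index type, whose linear order is the order of the
  coordinate indices.  A box $[a,b]$ is represented by the pair of its corners; a subdivision
  $\{Y^1,\dots,Y^M\}$ is the list of its boxes, so that its index set is \<open>{..<length Ys}\<close>
  (indices start from 0).
\<close>

type_synonym 'n corners = "(real ^ 'n) \<times> (real ^ 'n)"

definition is_box :: "'n::finite corners \<Rightarrow> bool" where
  "is_box Y \<longleftrightarrow> (\<forall>i. fst Y $ i < snd Y $ i)"

definition box_set :: "'n::finite corners \<Rightarrow> (real ^ 'n) set" where
  "box_set Y = cbox (fst Y) (snd Y)"

definition grad :: "(real ^ 'n::finite \<Rightarrow> real) \<Rightarrow> real ^ 'n \<Rightarrow> real ^ 'n" where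
  "grad f x = (\<chi> i. frechet_derivative f (at x) (axis i 1))"

definition hessian :: "(real ^ 'n::finite \<Rightarrow> real) \<Rightarrow> real ^ 'n \<Rightarrow> real ^ 'n ^ 'n" where
  "hessian f x = jacobian (grad f) (at x)"

definition twice_continuously_differentiable :: "(real ^ 'n::finite \<Rightarrow> real) \<Rightarrow> bool" where
  "twice_continuously_differentiable f \<longleftrightarrow>
     (\<forall>x. f differentiable (at x)) \<and> (\<forall>x. grad f differentiable (at x)) \<and>
     continuous_on UNIV (hessian f)"

text \<open>
  The minimum and maximum of a Hessian entry over a box exist for twice continuously
  differentiable \<open>f\<close>; otherwise the values below are unspecified.
\<close>

definition hess_min :: "(real ^ 'n::finite \<Rightarrow> real) \<Rightarrow> 'n corners \<Rightarrow> 'n \<Rightarrow> 'n \<Rightarrow> real" where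
  "hess_min f Y i j = (LEAST m. m \<in> (\<lambda>x. hessian f x $ i $ j) ` box_set Y)"

definition hess_max :: "(real ^ 'n::finite \<Rightarrow> real) \<Rightarrow> 'n corners \<Rightarrow> 'n \<Rightarrow> 'n \<Rightarrow> real" where
  "hess_max f Y i j = (GREATEST m. m \<in> (\<lambda>x. hessian f x $ i $ j) ` box_set Y)"

definition S_sum :: "(real ^ 'n::finite \<Rightarrow> real) \<Rightarrow> 'n corners \<Rightarrow> 'n \<Rightarrow> real ^ 'n \<Rightarrow> real" where
  "S_sum f Y i d =
     (\<Sum>j\<in>UNIV - {i}. max \<bar>hess_min f Y i j\<bar> \<bar>hess_max f Y i j\<bar> * (d $ j / d $ i))"

text \<open>In the next definition \<open>1 :: real ^ 'n\<close> is the vector all of whose entries are 1.\<close>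

definition lambda_tilde :: "(real ^ 'n::finite \<Rightarrow> real) \<Rightarrow> 'n corners \<Rightarrow> real" where
  "lambda_tilde f Y = Min (range (\<lambda>i. hess_min f Y i i - S_sum f Y i 1))"

definition M1 :: "(real ^ 'n::finite \<Rightarrow> real) \<Rightarrow> 'n corners list \<Rightarrow> nat set" where
  "M1 f Ys = {k. k < length Ys \<and> lambda_tilde f (Ys ! k) \<ge> 0}"

definition M2 :: "(real ^ 'n::finite \<Rightarrow> real) \<Rightarrow> 'n corners list \<Rightarrow> nat set" where
  "M2 f Ys = {k. k < length Ys \<and> lambda_tilde f (Ys ! k) < 0}"

definition is_subdivision :: "'n::finite corners \<Rightarrow> 'n corners list \<Rightarrow> bool" where
  "is_subdivision X Ys \<longleftrightarrow>
     (\<forall>k<length Ys. is_box (Ys ! k)) \<and>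
     box_set X = (\<Union>k<length Ys. box_set (Ys ! k)) \<and>
     (\<forall>k<length Ys. \<forall>j<length Ys. k \<noteq> j \<longrightarrow>
        box_set (Ys ! k) \<inter> box_set (Ys ! j) \<in> null_sets lebesgue)"

definition longest_edge :: "'n::{finite,linorder} corners \<Rightarrow> 'n" where
  "longest_edge Y = Min {i. \<forall>j. snd Y $ j - fst Y $ j \<le> snd Y $ i - fst Y $ i}"

definition halve :: "'n::{finite,linorder} corners \<Rightarrow> 'n corners list" where
  "halve Y =
     (let a = fst Y; b = snd Y; l = longest_edge Y; m = (a $ l + b $ l) / 2
      in [(a, \<chi> i. if i = l then m else b $ i), (\<chi> i. if i = l then m else a $ i, b)])"

primrec subdivision ::
  "(real ^ 'n::{finite,linorder} \<Rightarrow> real) \<Rightarrow> 'n corners \<Rightarrow> nat \<Rightarrow> 'n corners list" where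
  "subdivision f X 0 = [X]"
| "subdivision f X (Suc t) =
     concat (map (\<lambda>Y. if lambda_tilde f Y \<ge> 0 then [Y] else halve Y) (subdivision f X t))"

definition alpha :: "(real ^ 'n::finite \<Rightarrow> real) \<Rightarrow> 'n corners \<Rightarrow> 'n \<Rightarrow> real" where
  "alpha f Y i =
     (if lambda_tilde f Y \<ge> 0 then 0
      else max 0 (- (1 / 2) * (hess_min f Y i i - S_sum f Y i (snd Y - fst Y))))"

definition F_alpha :: "(real ^ 'n::finite \<Rightarrow> real) \<Rightarrow> 'n corners \<Rightarrow> real ^ 'n \<Rightarrow> real" where
  "F_alpha f Y x = f x + (\<Sum>i\<in>UNIV. alpha f Y i * (fst Y $ i - x $ i) * (snd Y $ i - x $ i))"

definition X_ap_box :: "(real ^ 'n::finite \<Rightarrow> real) \<Rightarrow> 'n corners \<Rightarrow> (real ^ 'n) set" where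
  "X_ap_box f Y = {x \<in> box_set Y. \<forall>y\<in>box_set Y. F_alpha f Y x \<le> F_alpha f Y y}"

definition X_ap_CNC :: "(real ^ 'n::finite \<Rightarrow> real) \<Rightarrow> 'n corners list \<Rightarrow> (real ^ 'n) set" where
  "X_ap_CNC f Ys = (\<Union>k\<in>M1 f Ys. X_ap_box f (Ys ! k)) \<union> (\<Union>k\<in>M2 f Ys. X_ap_box f (Ys ! k))"

definition X_ap :: "(real ^ 'n::finite \<Rightarrow> real) \<Rightarrow> 'n corners list \<Rightarrow> (real ^ 'n) set" where
  "X_ap f Ys = {x \<in> X_ap_CNC f Ys. \<forall>y\<in>X_ap_CNC f Ys. f x \<le> f y}"

definition X_op :: "(real ^ 'n::finite \<Rightarrow> real) \<Rightarrow> 'n corners \<Rightarrow> real \<Rightarrow> (real ^ 'n) set" where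
  "X_op f X \<epsilon> = {x \<in> box_set X. \<forall>y\<in>box_set X. f x \<le> f y + \<epsilon>}"

definition max_over :: "'k set \<Rightarrow> ('k \<Rightarrow> real) \<Rightarrow> real" where
  "max_over K g = (if K = {} then 0 else Max (g ` K))"

end

theory Submission
  imports Defs
begin

text \<open>
  With $c_k = \sum_i \alpha_i^k ((b_i^k - a_i^k)/2)^2$ the relaxation satisfies
  $f - c_k \le F_k \le f$ on $Y^k$, so a point at which $f$ is minimal among the minimizers of all
  the $F_k$ is $(\max_k c_k)$-optimal for $f$; convexity of the $F_k$ plays no role.
  The Hessian entries are bounded on $X$ and $c_k = 0$ unless $k \in M_2(t)$, so $c_k$ is at most a
  constant times the squared diagonal of $Y^k$.  A box with index in $M_2(t)$ has been bisected at
  each of the $t$ steps, and each bisection of a longest edge shrinks the squared diagonal by the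
  factor $1 - 3/(4n)$; hence $c_k \to 0$ uniformly.
\<close>

section \<open>Edge widths and the squared diagonal\<close>

definition width :: "'n::finite corners \<Rightarrow> 'n \<Rightarrow> real" where
  "width Y i = snd Y $ i - fst Y $ i"

definition sq_diagonal :: "'n::finite corners \<Rightarrow> real" where
  "sq_diagonal Y = (\<Sum>i\<in>UNIV. (width Y i)\<^sup>2)"

text \<open>The constant $c_k$ from above: the largest value of \<open>f x - F_alpha f Y x\<close>
  on a box, taken at its midpoint.\<close>

definition relax_gap :: "(real ^ 'n::finite \<Rightarrow> real) \<Rightarrow> 'n corners \<Rightarrow> real" where
  "relax_gap f Y = (\<Sum>i\<in>UNIV. alpha f Y i * ((fst Y $ i - snd Y $ i) / 2)\<^sup>2)"

lemma mem_box_set: "x \<in> box_set Y \<longleftrightarrow> (\<forall>i. fst Y $ i \<le> x $ i \<and> x $ i \<le> snd Y $ i)"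
  by (simp add: box_set_def mem_box_cart)

lemma box_set_nonempty: "is_box Y \<Longrightarrow> box_set Y \<noteq> {}"
  using mem_box_set[of "fst Y" Y] by (auto simp: is_box_def less_imp_le)

lemma compact_box_set: "compact (box_set Y)"
  by (simp add: box_set_def)

lemma width_nonneg: "is_box Y \<Longrightarrow> width Y i \<ge> 0"
  by (simp add: is_box_def width_def less_imp_le)

text \<open>Arithmetic-geometric mean inequality. Products of two widths arise when the edge ratios
  in \<open>S_sum\<close> are multiplied by a squared width.\<close>

lemma width_mult_le_sq_diagonal: "width Y i * width Y j \<le> sq_diagonal Y"
proof -
  have le: "(width Y k)\<^sup>2 \<le> sq_diagonal Y" for k
    unfolding sq_diagonal_def by (rule member_le_sum) auto
  have "0 \<le> (width Y i - width Y j)\<^sup>2" by simp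
  then have "2 * (width Y i * width Y j) \<le> (width Y i)\<^sup>2 + (width Y j)\<^sup>2"
    by (simp add: power2_eq_square algebra_simps)
  then show ?thesis using le[of i] le[of j] by linarith
qed

lemma width_le_longest_edge:
  fixes Y :: "'n::{finite,linorder} corners"
  shows "width Y j \<le> width Y (longest_edge Y)"
proof -
  let ?A = "{i. \<forall>j. snd Y $ j - fst Y $ j \<le> snd Y $ i - fst Y $ i}"
  \<comment> \<open>\<open>Min\<close> of an empty set is unspecified, so a coordinate of maximal
    width has to be exhibited first.\<close>
  obtain i where "width Y i = Max (range (width Y))"
    using Max_in[of "range (width Y)"] by (metis UNIV_not_empty finite finite_imageI image_is_empty imageE)
  then have "width Y j \<le> width Y i" for j by simp
  then have "i \<in> ?A" by (simp add: width_def)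
  then have "longest_edge Y \<in> ?A"
    unfolding longest_edge_def by (intro Min_in) auto
  then show ?thesis by (auto simp: width_def)
qed

section \<open>Bisection of a box\<close>

lemma width_halve:
  fixes Y Z :: "'n::{finite,linorder} corners"
  assumes "Z \<in> set (halve Y)"
  shows "width Z i = (if i = longest_edge Y then width Y i / 2 else width Y i)"
  using assms by (auto simp: halve_def Let_def width_def field_simps)

lemma is_box_halve:
  fixes Y Z :: "'n::{finite,linorder} corners"
  assumes "is_box Y" "Z \<in> set (halve Y)"
  shows "is_box Z"
proof -
  have pos_iff: "is_box A \<longleftrightarrow> (\<forall>i. width A i > 0)" for A :: "'n corners"
    by (simp add: is_box_def width_def)
  show ?thesis using assms(1) unfolding pos_iff width_halve[OF assms(2)] by simp
qed

text \<open>Halving removes 3/4 of the longest squared width from the sum, and this squared width is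
  at least the average \<open>sq_diagonal Y / CARD('n)\<close>.\<close>

lemma sq_diagonal_halve:
  fixes Y Z :: "'n::{finite,linorder} corners"
  assumes "is_box Y" and Z: "Z \<in> set (halve Y)"
  shows "sq_diagonal Z \<le> (1 - 3 / (4 * real CARD('n))) * sq_diagonal Y"
proof -
  define l where "l = longest_edge Y"
  have "sq_diagonal Z = (\<Sum>i\<in>UNIV. (width Y i)\<^sup>2 - (if i = l then 3 / 4 * (width Y l)\<^sup>2 else 0))"
    unfolding sq_diagonal_def
    by (intro sum.cong) (auto simp: width_halve[OF Z] l_def power2_eq_square)
  then have Z_eq: "sq_diagonal Z = sq_diagonal Y - 3 / 4 * (width Y l)\<^sup>2"
    by (simp add: sq_diagonal_def sum_subtractf)
  have "sq_diagonal Y \<le> (\<Sum>i\<in>(UNIV::'n set). (width Y l)\<^sup>2)"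
    unfolding sq_diagonal_def l_def
    by (intro sum_mono power_mono width_le_longest_edge width_nonneg assms)
  then have "sq_diagonal Y \<le> CARD('n) * (width Y l)\<^sup>2" by simp
  then have "sq_diagonal Y / CARD('n) \<le> (width Y l)\<^sup>2"
    by (simp add: divide_le_eq mult.commute)
  then have "3 / 4 * (sq_diagonal Y / real CARD('n)) \<le> 3 / 4 * (width Y l)\<^sup>2" by simp
  moreover have "(1 - 3 / (4 * real CARD('n))) * sq_diagonal Y =
      sq_diagonal Y - 3 / 4 * (sq_diagonal Y / real CARD('n))"
    by (simp add: field_simps)
  ultimately show ?thesis unfolding Z_eq by linarith
qed

text \<open>A half-space description of the two halves. Covering and negligible overlap follow from
  it alone, whatever edge and cutting point are used.\<close>

lemma box_sets_halve:
  fixes Y :: "'n::{finite,linorder} corners"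
  assumes "is_box Y"
  obtains L R l m where "halve Y = [L, R]"
    "box_set L = {x \<in> box_set Y. x $ l \<le> m}" "box_set R = {x \<in> box_set Y. m \<le> x $ l}"
proof -
  define l where "l = longest_edge Y"
  define m where "m = (fst Y $ l + snd Y $ l) / 2"
  define L R where "L = (fst Y, \<chi> i. if i = l then m else snd Y $ i)"
    and "R = (\<chi> i. if i = l then m else fst Y $ i, snd Y)"
  have "fst Y $ l < snd Y $ l" using assms by (simp add: is_box_def)
  \<comment> \<open>The second bound keeps \<open>L\<close> inside \<open>Y\<close>, the first one
    \<open>R\<close>.\<close>
  then have m: "fst Y $ l \<le> m" "m \<le> snd Y $ l" by (simp_all add: m_def)
  have "x \<in> box_set L \<longleftrightarrow> x \<in> box_set Y \<and> x $ l \<le> m" for x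
    using m(2) unfolding mem_box_set L_def by (fastforce split: if_splits)
  moreover have "x \<in> box_set R \<longleftrightarrow> x \<in> box_set Y \<and> m \<le> x $ l" for x
    using m(1) unfolding mem_box_set R_def by (fastforce split: if_splits)
  moreover have "halve Y = [L, R]"
    unfolding halve_def Let_def L_def R_def m_def l_def by (rule refl)
  ultimately show thesis by (intro that) auto
qed

lemma box_set_halve:
  fixes Y :: "'n::{finite,linorder} corners"
  assumes "is_box Y"
  shows "(\<Union>Z\<in>set (halve Y). box_set Z) = box_set Y"
  by (rule box_sets_halve[OF assms]) auto

text \<open>Meant for \<open>sorted_wrt\<close>, which compares list positions, as
  \<open>is_subdivision\<close> does, and splits along appended lists. Negligibility passes to
  arbitrary subsets.\<close>

definition almost_disjoint :: "'n::finite corners \<Rightarrow> 'n corners \<Rightarrow> bool" where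
  "almost_disjoint Y Z \<longleftrightarrow> negligible (box_set Y \<inter> box_set Z)"

lemma almost_disjoint_halve:
  fixes Y :: "'n::{finite,linorder} corners"
  assumes "is_box Y"
  shows "sorted_wrt almost_disjoint (halve Y)"
proof (rule box_sets_halve[OF assms])
  fix L R :: "'n corners" and l m
  assume halve: "halve Y = [L, R]"
    and L: "box_set L = {x \<in> box_set Y. x $ l \<le> m}" and R: "box_set R = {x \<in> box_set Y. m \<le> x $ l}"
  have "box_set L \<inter> box_set R \<subseteq> {x. x $ l = m}" unfolding L R by auto
  moreover have "negligible {x. x $ l = m}"
    by (simp add: cart_eq_inner_axis negligible_standard_hyperplane)
  ultimately have "almost_disjoint L R"
    unfolding almost_disjoint_def by (metis negligible_subset)
  then show ?thesis unfolding halve by simp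
qed

text \<open>Pieces of the same box are covered by the assumption on \<open>g\<close>; pieces of
  different boxes overlap inside the negligible overlap of their parents.\<close>

lemma sorted_wrt_almost_disjoint_refine:
  assumes "sorted_wrt almost_disjoint Ys"
    and "\<And>Y. Y \<in> set Ys \<Longrightarrow> sorted_wrt almost_disjoint (g Y)"
    and sub: "\<And>Y Z. Y \<in> set Ys \<Longrightarrow> Z \<in> set (g Y) \<Longrightarrow> box_set Z \<subseteq> box_set Y"
  shows "sorted_wrt almost_disjoint (concat (map g Ys))"
  using assms
proof (induction Ys)
  case (Cons Y Ys)
  have "almost_disjoint A B"
    if "A \<in> set (g Y)" "Z \<in> set Ys" "B \<in> set (g Z)" for A B Z
  proof -
    have "almost_disjoint Y Z" using Cons.prems(1) that by simp
    moreover have "box_set A \<subseteq> box_set Y" "box_set B \<subseteq> box_set Z"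
      using Cons.prems(3) that by auto
    ultimately show ?thesis
      unfolding almost_disjoint_def by (meson Int_mono negligible_subset)
  qed
  then show ?case using Cons by (auto simp: sorted_wrt_append)
qed simp

text \<open>\<open>sorted_wrt\<close> only compares an entry with later ones; symmetry of the
  intersection gives the other order.\<close>

lemma is_subdivisionI:
  assumes box: "\<And>Y. Y \<in> set Ys \<Longrightarrow> is_box Y"
    and un: "(\<Union>Y\<in>set Ys. box_set Y) = box_set X"
    and disj: "sorted_wrt almost_disjoint Ys"
  shows "is_subdivision X Ys"
proof -
  have "almost_disjoint (Ys ! k) (Ys ! j)" if "k < length Ys" "j < length Ys" "k \<noteq> j" for k j
  proof (cases "k < j")
    case True
    then show ?thesis using disj that by (simp add: sorted_wrt_iff_nth_less)
  next
    case False
    then have "almost_disjoint (Ys ! j) (Ys ! k)"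
      using disj that by (simp add: sorted_wrt_iff_nth_less)
    then show ?thesis by (simp add: almost_disjoint_def Int_commute)
  qed
  moreover have "(\<Union>k<length Ys. box_set (Ys ! k)) = box_set X"
    unfolding un[symmetric] by (force simp: in_set_conv_nth)
  ultimately show ?thesis
    using box by (auto simp: is_subdivision_def almost_disjoint_def negligible_iff_null_sets)
qed

section \<open>The generated subdivisions\<close>

lemma subdivision_box:
  assumes "is_box X" "Y \<in> set (subdivision f X t)"
  shows "is_box Y"
  using assms(2)
proof (induction t arbitrary: Y)
  case (Suc t)
  obtain Z where "Z \<in> set (subdivision f X t)"
    "Y \<in> set (if lambda_tilde f Z \<ge> 0 then [Z] else halve Z)"
    using Suc.prems unfolding subdivision.simps set_concat set_map by blast
  then show ?case using Suc.IH[of Z] is_box_halve[of Z Y] by (auto split: if_splits)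
qed (simp add: assms(1))

lemma Union_subdivision:
  assumes "is_box X"
  shows "(\<Union>Y\<in>set (subdivision f X t). box_set Y) = box_set X"
proof (induction t)
  case (Suc t)
  have "(\<Union>Y\<in>set (subdivision f X (Suc t)). box_set Y) =
      (\<Union>Y\<in>set (subdivision f X t). \<Union>Z\<in>set (if lambda_tilde f Y \<ge> 0 then [Y] else halve Y). box_set Z)"
    by (simp only: subdivision.simps set_concat set_map SUP_UNION image_image UN_UN_flatten)
  also have "\<dots> = (\<Union>Y\<in>set (subdivision f X t). box_set Y)"
    by (intro SUP_cong refl) (auto simp: box_set_halve[OF subdivision_box[OF assms]] split: if_splits)
  finally show ?case using Suc by simp
qed simp

lemma almost_disjoint_subdivision:
  assumes "is_box X"
  shows "sorted_wrt almost_disjoint (subdivision f X t)"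
proof (induction t)
  case (Suc t)
  show ?case unfolding subdivision.simps
  proof (rule sorted_wrt_almost_disjoint_refine[OF Suc])
    fix Y Z assume Y: "Y \<in> set (subdivision f X t)"
      and Z: "Z \<in> set (if lambda_tilde f Y \<ge> 0 then [Y] else halve Y)"
    show "box_set Z \<subseteq> box_set Y"
      using Z box_set_halve[OF subdivision_box[OF assms Y]] by (auto split: if_splits)
  qed (simp add: almost_disjoint_halve subdivision_box[OF assms])
qed simp

lemma is_subdivision_subdivision: "is_box X \<Longrightarrow> is_subdivision X (subdivision f X t)"
  by (rule is_subdivisionI[OF subdivision_box Union_subdivision almost_disjoint_subdivision])

text \<open>
  A box that fails the convexity test at step \<open>t\<close> cannot have been kept at an earlier step, since the
  test depends on the box alone.
\<close>

lemma sq_diagonal_subdivision: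
  fixes X :: "'n::{finite,linorder} corners"
  assumes "is_box X" "Y \<in> set (subdivision f X t)" "lambda_tilde f Y < 0"
  shows "sq_diagonal Y \<le> (1 - 3 / (4 * real CARD('n))) ^ t * sq_diagonal X"
  using assms(2,3)
proof (induction t arbitrary: Y)
  case (Suc t)
  define q where "q = 1 - 3 / (4 * real CARD('n))"
  \<comment> \<open>There is at least one coordinate, so \<open>q\<close> is nonnegative and the
    induction hypothesis may be multiplied by it.\<close>
  have "3 \<le> 4 * real CARD('n)" using one_le_card_finite[where 'a='n] by linarith
  then have q: "q \<ge> 0" by (simp add: q_def divide_le_eq_1)
  obtain Z where Z: "Z \<in> set (subdivision f X t)" "lambda_tilde f Z < 0" "Y \<in> set (halve Z)"
    using Suc.prems by (auto split: if_splits)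
  have "sq_diagonal Y \<le> q * sq_diagonal Z"
    unfolding q_def by (rule sq_diagonal_halve[OF subdivision_box[OF assms(1) Z(1)] Z(3)])
  also have "\<dots> \<le> q * (q ^ t * sq_diagonal X)"
    using Suc.IH[OF Z(1,2)] q by (intro mult_left_mono) (simp_all add: q_def)
  finally show ?case by (simp add: q_def mult.assoc)
qed simp

section \<open>Bounds for the Hessian entries\<close>

lemma hess_min_max_in_image:
  fixes Y :: "'n::finite corners"
  assumes "continuous_on UNIV (hessian f)" "is_box Y"
  shows "hess_min f Y i j \<in> (\<lambda>x. hessian f x $ i $ j) ` box_set Y"
    and "hess_max f Y i j \<in> (\<lambda>x. hessian f x $ i $ j) ` box_set Y"
proof -
  let ?h = "\<lambda>x. hessian f x $ i $ j"
  have cont: "continuous_on (box_set Y) ?h"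
    by (intro continuous_intros continuous_on_subset[OF assms(1)]) auto
  \<comment> \<open>\<open>LEAST\<close> and \<open>GREATEST\<close> are meaningful only for
    attained extrema, which compactness of the box supplies.\<close>
  obtain x where "x \<in> box_set Y" "\<forall>y\<in>box_set Y. ?h x \<le> ?h y"
    using continuous_attains_inf[OF compact_box_set box_set_nonempty[OF assms(2)] cont] by blast
  moreover from this have "hess_min f Y i j = ?h x"
    unfolding hess_min_def by (intro Least_equality) auto
  ultimately show "hess_min f Y i j \<in> ?h ` box_set Y" by blast
  obtain x where "x \<in> box_set Y" "\<forall>y\<in>box_set Y. ?h y \<le> ?h x"
    using continuous_attains_sup[OF compact_box_set box_set_nonempty[OF assms(2)] cont] by blast
  moreover from this have "hess_max f Y i j = ?h x"
    unfolding hess_max_def by (intro Greatest_equality) auto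
  ultimately show "hess_max f Y i j \<in> ?h ` box_set Y" by blast
qed

text \<open>One constant for all entries on all of \<open>X\<close>, hence for every box of every
  subdivision, independently of the step.\<close>

lemma hessian_bounded_on_box:
  fixes X :: "'n::finite corners"
  assumes "continuous_on UNIV (hessian f)"
  obtains H where "H \<ge> 0" "\<And>x i j. x \<in> box_set X \<Longrightarrow> \<bar>hessian f x $ i $ j\<bar> \<le> H"
proof -
  have "bounded (hessian f ` box_set X)"
    by (intro compact_imp_bounded compact_continuous_image compact_box_set
        continuous_on_subset[OF assms]) simp
  then obtain H where H: "H > 0" "\<And>x. x \<in> box_set X \<Longrightarrow> norm (hessian f x) \<le> H"
    by (auto simp: bounded_pos)
  have entry_le: "\<bar>hessian f x $ i $ j\<bar> \<le> norm (hessian f x)" for x i j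
    using component_le_norm_cart[of "hessian f x $ i" j] Finite_Cartesian_Product.norm_nth_le[of "hessian f x" i]
    by linarith
  show thesis
    by (rule that[OF less_imp_le[OF H(1)] order_trans[OF entry_le H(2)]])
qed

section \<open>Size of the relaxation gap\<close>

lemma alpha_nonneg: "alpha f Y i \<ge> 0"
  by (simp add: alpha_def)

lemma relax_gap_le_sq_diagonal:
  fixes Y :: "'n::finite corners"
  assumes cont: "continuous_on UNIV (hessian f)" and box: "is_box Y"
    and H: "H \<ge> 0" "\<And>x i j. x \<in> box_set Y \<Longrightarrow> \<bar>hessian f x $ i $ j\<bar> \<le> H"
  shows "relax_gap f Y \<le> (real CARD('n))\<^sup>2 * H * sq_diagonal Y"
proof -
  have min: "\<bar>hess_min f Y i j\<bar> \<le> H" and max: "\<bar>hess_max f Y i j\<bar> \<le> H" for i j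
    using hess_min_max_in_image[OF cont box, of i j] H(2) by auto
  have pos: "width Y i > 0" for i using box by (simp add: is_box_def width_def)
  have "alpha f Y i * ((fst Y $ i - snd Y $ i) / 2)\<^sup>2 \<le> CARD('n) * (H * sq_diagonal Y)" for i
  proof -
    let ?w = "width Y"
    \<comment> \<open>Here \<open>B\<close> will be the sum over all \<open>j\<close>. Its
      nonnegativity covers the convex case and the maximum with 0, and allows the factor 1/2 to be
      dropped.\<close>
    have if_bound: "(if P then 0 else max 0 (- (1 / 2) * T)) \<le> B"
      if "- T \<le> B" "0 \<le> B" for P and T B :: real
      using that by auto
    have "S_sum f Y i (snd Y - fst Y) \<le> (\<Sum>j\<in>UNIV - {i}. H * (?w j / ?w i))"
      unfolding S_sum_def vector_minus_component width_def[symmetric]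
      by (intro sum_mono mult_right_mono max.boundedI min max divide_nonneg_pos less_imp_le[OF pos] pos)
    \<comment> \<open>The ratio 1 is written as a quotient so that the diagonal term is the summand
      \<open>j = i\<close> missing from \<open>S_sum\<close>.\<close>
    moreover have "- hess_min f Y i i \<le> H * (?w i / ?w i)"
      using min[of i i] pos[of i] by simp
    moreover have "(\<Sum>j\<in>UNIV. H * (?w j / ?w i)) =
        H * (?w i / ?w i) + (\<Sum>j\<in>UNIV - {i}. H * (?w j / ?w i))"
      by (rule sum.remove) auto
    ultimately have "- (hess_min f Y i i - S_sum f Y i (snd Y - fst Y)) \<le>
        (\<Sum>j\<in>UNIV. H * (?w j / ?w i))" by linarith
    moreover have nonneg: "0 \<le> (\<Sum>j\<in>UNIV. H * (?w j / ?w i))"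
      using H(1) pos by (intro sum_nonneg mult_nonneg_nonneg divide_nonneg_pos less_imp_le[OF pos])
    ultimately have "alpha f Y i \<le> (\<Sum>j\<in>UNIV. H * (?w j / ?w i))"
      unfolding alpha_def by (intro if_bound)
    moreover have "((fst Y $ i - snd Y $ i) / 2)\<^sup>2 \<le> (?w i)\<^sup>2"
      by (simp add: width_def power_divide power2_commute)
    ultimately have "alpha f Y i * ((fst Y $ i - snd Y $ i) / 2)\<^sup>2 \<le>
        (\<Sum>j\<in>UNIV. H * (?w j / ?w i)) * (?w i)\<^sup>2"
      using nonneg by (intro mult_mono) auto
    \<comment> \<open>The denominator \<open>?w i\<close> cancels against one factor of the
      square.\<close>
    also have "\<dots> = (\<Sum>j\<in>UNIV. H * (?w j * ?w i))"
      using pos[of i] by (simp add: sum_distrib_right power2_eq_square)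
    also have "\<dots> \<le> (\<Sum>j\<in>(UNIV::'n set). H * sq_diagonal Y)"
      by (intro sum_mono mult_left_mono width_mult_le_sq_diagonal H)
    finally show ?thesis by simp
  qed
  then have "relax_gap f Y \<le> (\<Sum>i\<in>(UNIV::'n set). CARD('n) * (H * sq_diagonal Y))"
    unfolding relax_gap_def by (intro sum_mono)
  then show ?thesis by (simp add: power2_eq_square mult.assoc)
qed

section \<open>Comparison of the relaxation with the function\<close>

lemma F_alpha_le:
  assumes "x \<in> box_set Y"
  shows "F_alpha f Y x \<le> f x"
proof -
  have "alpha f Y i * (fst Y $ i - x $ i) * (snd Y $ i - x $ i) \<le> 0" for i
    using assms alpha_nonneg[of f Y i]
    by (intro mult_nonpos_nonneg mult_nonneg_nonpos) (auto simp: mem_box_set)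
  then show ?thesis by (simp add: F_alpha_def sum_nonpos)
qed

text \<open>Completing the square about the midpoint turns each summand into a nonnegative multiple
  of a square, for \<open>x\<close> inside or outside the box.\<close>

lemma le_F_alpha_plus_relax_gap: "f x \<le> F_alpha f Y x + relax_gap f Y"
proof -
  have "0 \<le> alpha f Y i * (fst Y $ i - x $ i) * (snd Y $ i - x $ i) +
      alpha f Y i * ((fst Y $ i - snd Y $ i) / 2)\<^sup>2" for i
  proof -
    have "alpha f Y i * (fst Y $ i - x $ i) * (snd Y $ i - x $ i) +
        alpha f Y i * ((fst Y $ i - snd Y $ i) / 2)\<^sup>2 =
        alpha f Y i * (x $ i - (fst Y $ i + snd Y $ i) / 2)\<^sup>2"
      by (simp add: power2_eq_square field_simps)
    then show ?thesis using alpha_nonneg[of f Y i] by simp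
  qed
  then show ?thesis
    by (simp add: F_alpha_def relax_gap_def sum.distrib[symmetric] sum_nonneg)
qed

text \<open>Ensures that every box contributes a candidate with which the points of that box can be
  compared.\<close>

lemma X_ap_box_nonempty:
  assumes "continuous_on UNIV f" "is_box Y"
  shows "X_ap_box f Y \<noteq> {}"
proof -
  have "continuous_on (box_set Y) (F_alpha f Y)"
    unfolding F_alpha_def by (intro continuous_intros continuous_on_subset[OF assms(1)]) auto
  from continuous_attains_inf[OF compact_box_set box_set_nonempty[OF assms(2)] this]
  show ?thesis by (auto simp: X_ap_box_def)
qed

text \<open>The sign of \<open>lambda_tilde\<close> splits the indices exhaustively, so the two
  unions merge into one over all boxes.\<close>

lemma X_ap_CNC_eq: "X_ap_CNC f Ys = (\<Union>Y\<in>set Ys. X_ap_box f Y)"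
proof -
  have "M1 f Ys \<union> M2 f Ys = {..<length Ys}" by (auto simp: M1_def M2_def)
  then have "X_ap_CNC f Ys = (\<Union>k\<in>{..<length Ys}. X_ap_box f (Ys ! k))"
    by (simp only: X_ap_CNC_def flip: UN_Un)
  also have "\<dots> = (\<Union>Y\<in>set Ys. X_ap_box f Y)" by (auto simp: set_conv_nth)
  finally show ?thesis .
qed

lemma X_ap_subset_X_op:
  assumes cont: "continuous_on UNIV f"
    and box: "\<And>Y. Y \<in> set Ys \<Longrightarrow> is_box Y"
    and un: "(\<Union>Y\<in>set Ys. box_set Y) = box_set X"
    and gap: "\<And>Y. Y \<in> set Ys \<Longrightarrow> relax_gap f Y \<le> \<epsilon>"
  shows "X_ap f Ys \<subseteq> X_op f X \<epsilon>"
proof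
  fix x assume x: "x \<in> X_ap f Ys"
  have "x \<in> box_set X"
    unfolding un[symmetric] using x by (auto simp: X_ap_def X_ap_CNC_eq X_ap_box_def)
  moreover have "f x \<le> f y + \<epsilon>" if "y \<in> box_set X" for y
  proof -
    have "y \<in> (\<Union>Y\<in>set Ys. box_set Y)" using that by (simp only: un)
    then obtain Y where Y: "Y \<in> set Ys" "y \<in> box_set Y" by blast
    \<comment> \<open>The minimizer is taken on the box containing \<open>y\<close>: it is a
      candidate, so \<open>x\<close> is no worse than \<open>z\<close>, and \<open>z\<close> is no
      worse than \<open>y\<close> up to the gap of \<open>Y\<close>.\<close>
    obtain z where z: "z \<in> X_ap_box f Y" using X_ap_box_nonempty[OF cont box[OF Y(1)]] by blast
    have "f x \<le> f z" using x z Y(1) by (auto simp: X_ap_def X_ap_CNC_eq)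
    also have "f z \<le> F_alpha f Y z + relax_gap f Y" by (rule le_F_alpha_plus_relax_gap)
    also have "F_alpha f Y z \<le> F_alpha f Y y" using z Y by (simp add: X_ap_box_def)
    also have "F_alpha f Y y \<le> f y" by (rule F_alpha_le[OF Y(2)])
    finally show ?thesis using gap[OF Y(1)] by simp
  qed
  ultimately show "x \<in> X_op f X \<epsilon>" by (simp add: X_op_def)
qed

section \<open>Choice of the number of division steps\<close>

lemma relax_gap_subdivision_small:
  fixes X :: "'n::{finite,linorder} corners"
  assumes X: "is_box X" and cont: "continuous_on UNIV (hessian f)" and "\<epsilon> > 0"
  obtains t where "\<And>Y. Y \<in> set (subdivision f X t) \<Longrightarrow> relax_gap f Y \<le> \<epsilon>"
proof -
  obtain H where H: "H \<ge> 0" "\<And>x i j. x \<in> box_set X \<Longrightarrow> \<bar>hessian f x $ i $ j\<bar> \<le> H"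
    by (rule hessian_bounded_on_box[OF cont, of X]) blast
  define q where "q = 1 - 3 / (4 * real CARD('n))"
  \<comment> \<open>The factor from \<open>relax_gap_le_sq_diagonal\<close>, with \<open>H\<close>
    taken on the whole of \<open>X\<close> so that \<open>C\<close> does not depend on
    \<open>t\<close>.\<close>
  define C where "C = (real CARD('n))\<^sup>2 * H"
  have "3 \<le> 4 * real CARD('n)" using one_le_card_finite[where 'a='n] by linarith
  then have "0 \<le> q" by (simp add: q_def divide_le_eq_1)
  have "q < 1" by (simp add: q_def)
  then have "(\<lambda>t. C * (q ^ t * sq_diagonal X)) \<longlonglongrightarrow> C * (0 * sq_diagonal X)"
    using \<open>0 \<le> q\<close> by (intro tendsto_intros LIMSEQ_realpow_zero)
  then have "\<forall>\<^sub>F t in sequentially. C * (q ^ t * sq_diagonal X) < \<epsilon>"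
    using \<open>\<epsilon> > 0\<close> by (intro order_tendstoD(2)) auto
  then obtain t where t: "C * (q ^ t * sq_diagonal X) < \<epsilon>"
    by (auto simp: eventually_sequentially)
  have "relax_gap f Y \<le> \<epsilon>" if Y: "Y \<in> set (subdivision f X t)" for Y
  proof (cases "lambda_tilde f Y < 0")
    case True
    have "box_set Y \<subseteq> box_set X" unfolding Union_subdivision[OF X, of f t, symmetric] using Y by blast
    then have "relax_gap f Y \<le> C * sq_diagonal Y"
      unfolding C_def using H
      by (intro relax_gap_le_sq_diagonal cont subdivision_box[OF X Y]) auto
    also have "\<dots> \<le> C * (q ^ t * sq_diagonal X)"
      using sq_diagonal_subdivision[OF X Y True] H(1)
      by (intro mult_left_mono) (simp_all add: q_def C_def)
    finally show ?thesis using t by simp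
  next
    \<comment> \<open>A box that passes the convexity test may stay large, but its parameters
      vanish, so its gap is exactly 0.\<close>
    case False
    then show ?thesis using \<open>\<epsilon> > 0\<close> by (simp add: relax_gap_def alpha_def)
  qed
  then show thesis by (rule that)
qed

theorem theorem3p3:
  fixes f :: "real ^ 'n::{finite,linorder} \<Rightarrow> real"
    and a b :: "real ^ 'n::{finite,linorder}"
    and \<epsilon> :: real
  assumes "is_box (a, b)"
    and "twice_continuously_differentiable f"
    and "\<not> convex_on UNIV f"
    and "\<epsilon> > 0"
  shows "\<exists>t Ys. Ys = subdivision f (a, b) t \<and> is_subdivision (a, b) Ys \<and>
           max_over (M2 f Ys) (\<lambda>k. \<Sum>i\<in>UNIV. alpha f (Ys ! k) i *
             ((fst (Ys ! k) $ i - snd (Ys ! k) $ i) / 2) ^ 2) \<le> \<epsilon> \<and>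
           X_ap f Ys \<subseteq> X_op f (a, b) \<epsilon>"
proof -
  have cont_f: "continuous_on UNIV f" and cont_hess: "continuous_on UNIV (hessian f)"
    using assms(2)
    by (auto simp: twice_continuously_differentiable_def continuous_at_imp_continuous_on
        differentiable_imp_continuous_within)
  obtain t where t: "\<And>Y. Y \<in> set (subdivision f (a, b) t) \<Longrightarrow> relax_gap f Y \<le> \<epsilon>"
    by (rule relax_gap_subdivision_small[OF assms(1) cont_hess assms(4)]) blast
  let ?Ys = "subdivision f (a, b) t"
  \<comment> \<open>For empty \<open>M2 f ?Ys\<close> the value is 0 by convention, and \<epsilon>
    is positive.\<close>
  have "max_over (M2 f ?Ys) (\<lambda>k. relax_gap f (?Ys ! k)) \<le> \<epsilon>"
    using t assms(4) by (auto simp: max_over_def M2_def)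
  moreover have "X_ap f ?Ys \<subseteq> X_op f (a, b) \<epsilon>"
    by (intro X_ap_subset_X_op cont_f subdivision_box[OF assms(1)] Union_subdivision assms(1) t)
  ultimately show ?thesis
    unfolding relax_gap_def
    by (intro exI[of _ t] exI[of _ ?Ys] conjI refl is_subdivision_subdivision assms(1))
qed

end
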